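(* Let $(\tau',\tau^\star,\tau^\circ,\tau^\natural)\in\mathbb{R}_{>0}\times\mathbb{R}_{>0}\times[0,\tau^\star]\times[0,\min\{\tau^\circ,\tau'\}]$, let $T'=(t'_k)_{k\in\mathbb{N}_0}$ and $T^\star=(t^\star_k)_{k\in\mathbb{N}_0}$ be admissible event sequences satisfying the bounds (B) given in the context, and let $\Delta$ be the corresponding operator defined in the context. Then for every $v\in\mathbf{L}_2$, $$\|\Delta v\|_{\mathbf{L}_2}\le\Big(\tfrac{2(\tau'+\tau^\circ)}{\pi}+\sqrt{(\tau'+\tau^\circ)\,\tau^\natural}\Big)\|v\|_{\mathbf{L}_2}.$$
   Context: $\mathbb{N}_0$ denotes the non-negative integers. $\mathbf{L}_2$ is the space of square integrable functions $\mathbb{R}_{\ge 0}\to\mathbb{R}$ with usual norm $\|\cdot\|_{\mathbf{L}_2}$. $\mathbf{L}_{2e}$ is the set of functions $f:\mathbb{R}_{\ge0}\to\mathbb{R}$ whose truncation to $[0,\tau]$ (set to zero for $t>\tau$) is in $\mathbf{L}_2$ for every $\tau>0$. Admissible event sequence: $(t_k)_{k\in\mathbb{N}_0}\subset\mathbb{R}_{\ge0}$ with $t_0=0$, $t_{k+1}-t_k>0$ for all $k$, and $\lim_{k\to\infty}t_k=+\infty$. A sequence is also identified with its set of values. $T'=(t'_k)$ is the input sample event sequence and $T^\star=(t^\star_k)$ the output hold update event sequence. With $\phi_k=\min\{t : t\in T^\star\cap[t'_k,+\infty)\}$, the bounds (B) are, for all $k\in\mathbb{N}_0$: $0<t'_{k+1}-t'_k\le\tau'$;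 $0<t^\star_{k+1}-t^\star_k\le\tau^\star$; $\phi_k-t'_k\le\tau^\circ\le\tau^\star$; and $\phi_k-\max\{t : t\in T'\cap[0,\phi_k]\}\le\tau^\natural\le\min\{\tau^\circ,\tau'\}$. For $t\ge0$ let $n(t)=\max\{k\in\mathbb{N}_0 : t^\star_k\in[0,t]\}$, $p(t)=\max\{k\in\mathbb{N}_0 : t'_k\in[0,t]\}$, $q(t)=p(t^\star_{n(t)})$ and $\sigma''(t)=t-t'_{q(t)}$. Let $(\mathscr{R}_{\sigma''}v)(t)=v(t-\sigma''(t))$ (the argument equals $t'_{q(t)}\ge 0$), and let $(\mathscr{I}v)(t)=\int_0^t v(x)\,dx$. The operator $\Delta:\mathbf{L}_{2e}\to\mathbf{L}_{2e}$ is $\Delta=(\mathsf{id}-\mathscr{R}_{\sigma''})\mathscr{I}$, where $\mathsf{id}$ is the identity; i.e. $(\Delta v)(t)=(\mathscr{I}v)(t)-(\mathscr{I}v)(t'_{q(t)})$. *)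

theory Defs
  imports "HOL-Analysis.Analysis"
begin

text \<open>
  Functions on the half-line are represented by functions of type \<^typ>\<open>real \<Rightarrow> real\<close>; their
  values at negative arguments are never used.
\<close>

definition L2 :: "(real \<Rightarrow> real) set" where
  "L2 = {v. set_borel_measurable lebesgue {0..} v \<and>
            set_integrable lebesgue {0..} (\<lambda>t. (v t)\<^sup>2)}"

text \<open>Only meaningful on \<^const>\<open>L2\<close>: the integral of a non-integrable function is 0 by convention.\<close>

definition L2_norm :: "(real \<Rightarrow> real) \<Rightarrow> real" where
  "L2_norm v = sqrt (set_lebesgue_integral lebesgue {0..} (\<lambda>t. (v t)\<^sup>2))"

definition admissible :: "(nat \<Rightarrow> real) \<Rightarrow> bool" where
  "admissible t \<longleftrightarrow> (\<forall>k. 0 \<le> t k) \<and> t 0 = 0 \<and> (\<forall>k. t (Suc k) - t k > 0) \<and>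
     filterlim t at_top sequentially"

text \<open>
  In what follows \<open>s\<close> is the sequence of sample events and \<open>u\<close> the sequence of hold update
  events. The set in \<open>next_update\<close> is infinite, so its minimum is taken with \<open>LEAST\<close> rather than
  \<^const>\<open>Min\<close>; all sets to which \<^const>\<open>Max\<close> is applied are finite and nonempty for admissible
  sequences and nonnegative times.
\<close>

definition next_update :: "(nat \<Rightarrow> real) \<Rightarrow> (nat \<Rightarrow> real) \<Rightarrow> nat \<Rightarrow> real" where
  "next_update s u k = (LEAST t. t \<in> range u \<inter> {s k..})"

definition event_bounds ::
  "real \<Rightarrow> real \<Rightarrow> real \<Rightarrow> real \<Rightarrow> (nat \<Rightarrow> real) \<Rightarrow> (nat \<Rightarrow> real) \<Rightarrow> bool" where
  "event_bounds \<tau>s \<tau>u \<tau>d \<tau>n s u \<longleftrightarrow>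
     (\<forall>k. 0 < s (Suc k) - s k \<and> s (Suc k) - s k \<le> \<tau>s \<and>
          0 < u (Suc k) - u k \<and> u (Suc k) - u k \<le> \<tau>u \<and>
          next_update s u k - s k \<le> \<tau>d \<and> \<tau>d \<le> \<tau>u \<and>
          next_update s u k - Max (range s \<inter> {0..next_update s u k}) \<le> \<tau>n \<and>
          \<tau>n \<le> min \<tau>d \<tau>s)"

definition last_index :: "(nat \<Rightarrow> real) \<Rightarrow> real \<Rightarrow> nat" where
  "last_index e t = Max {k. e k \<in> {0..t}}"

definition held_index :: "(nat \<Rightarrow> real) \<Rightarrow> (nat \<Rightarrow> real) \<Rightarrow> real \<Rightarrow> nat" where
  "held_index s u t = last_index s (u (last_index u t))"

definition total_delay :: "(nat \<Rightarrow> real) \<Rightarrow> (nat \<Rightarrow> real) \<Rightarrow> real \<Rightarrow> real" where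
  "total_delay s u t = t - s (held_index s u t)"

definition delay_op :: "(real \<Rightarrow> real) \<Rightarrow> (real \<Rightarrow> real) \<Rightarrow> real \<Rightarrow> real" where
  "delay_op \<sigma> v t = v (t - \<sigma> t)"

definition integrator :: "(real \<Rightarrow> real) \<Rightarrow> real \<Rightarrow> real" where
  "integrator v t = set_lebesgue_integral lebesgue {0..t} v"

definition Delta :: "(nat \<Rightarrow> real) \<Rightarrow> (nat \<Rightarrow> real) \<Rightarrow> (real \<Rightarrow> real) \<Rightarrow> real \<Rightarrow> real" where
  "Delta s u v t = integrator v t - delay_op (total_delay s u) (integrator v) t"

end

theory Submission
  imports Defs
begin

text \<open>
  Let \<open>\<phi>\<^sub>k\<close> be the first update at or after the sample \<open>s\<^sub>k\<close>. The held sample at time \<open>t\<close> is \<open>s\<^sub>k\<close>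
  exactly for \<open>\<phi>\<^sub>k \<le> t < \<phi>\<^sub>k\<^sub>+\<^sub>1\<close>, and there \<open>\<Delta> v\<close> is the integral of \<open>v\<close> over \<open>[s\<^sub>k, \<phi>\<^sub>k]\<close> plus the
  integral over \<open>[\<phi>\<^sub>k, t]\<close>. A Wirtinger inequality on \<open>[\<phi>\<^sub>k, \<phi>\<^sub>k\<^sub>+\<^sub>1)\<close>, whose length is at most
  \<open>\<tau>s + \<tau>d\<close>, gives the first term of the constant. The first integral does not depend on \<open>t\<close>, and
  Cauchy-Schwarz with \<open>\<phi>\<^sub>k - s\<^sub>k \<le> \<tau>n\<close> gives the second. If \<open>[\<phi>\<^sub>k, \<phi>\<^sub>k\<^sub>+\<^sub>1)\<close> is nonempty then
  \<open>\<phi>\<^sub>k < s\<^sub>k\<^sub>+\<^sub>1\<close>, so the intervals \<open>[s\<^sub>k, \<phi>\<^sub>k]\<close> that occur are disjoint and both estimates can be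
  summed over \<open>k\<close>.
\<close>

section \<open>A Wirtinger inequality\<close>

lemma nn_integral_FTC_Icc_lborel_le:
  fixes f F :: "real \<Rightarrow> real"
  assumes "f \<in> borel_measurable borel" "a \<le> b"
    and "\<And>x. a \<le> x \<Longrightarrow> x \<le> b \<Longrightarrow> (F has_real_derivative f x) (at x)"
    and "\<And>x. a \<le> x \<Longrightarrow> x \<le> b \<Longrightarrow> 0 \<le> f x"
    and "F b - F a \<le> C"
  shows "(\<integral>\<^sup>+x\<in>{a..b}. ennreal (f x) \<partial>lborel) \<le> ennreal C"
proof -
  have "(\<integral>\<^sup>+x\<in>{a..b}. ennreal (f x) \<partial>lborel) = ennreal (F b - F a)"
    using assms by (intro nn_integral_FTC_Icc) (auto intro: has_field_derivative_at_within)
  then show ?thesis using assms(5) by (simp add: ennreal_leI)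
qed

text \<open>
  The weight in the Cauchy-Schwarz step is \<open>cos (\<pi> (x - a) / (2 (b - a)))\<close>, the derivative of an
  extremal \<open>t \<mapsto> \<integral>\<^sub>a\<^sup>t f\<close> of the inequality; integrating it from \<open>a\<close> to \<open>t\<close> and then from \<open>x\<close> to
  \<open>b\<close> reproduces it up to the factor \<open>(2 (b - a) / \<pi>)\<^sup>2\<close>.
\<close>

lemma wirtinger_nn_integral:
  fixes f :: "real \<Rightarrow> ennreal"
  assumes [measurable]: "f \<in> borel_measurable borel" and ab: "a < b"
  shows "(\<integral>\<^sup>+t\<in>{a..<b}. (\<integral>\<^sup>+x\<in>{a..t}. f x \<partial>lborel)\<^sup>2 \<partial>lborel)
    \<le> ennreal ((2 * (b - a) / pi)\<^sup>2) * (\<integral>\<^sup>+x\<in>{a..<b}. (f x)\<^sup>2 \<partial>lborel)"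
proof -
  \<comment> \<open>This scale makes \<open>r * (b - a) = pi / 2\<close>, so the weight
    \<open>w\<close> is positive on \<open>[a, b)\<close> and vanishes exactly at \<open>b\<close>.
    Its inverse \<open>1 / r\<close> is the constant of the lemma. \<open>S\<close> is the
    antiderivative of \<open>w\<close> that vanishes at \<open>a\<close>, and
    \<open>- w / r\<^sup>2\<close> is an antiderivative of \<open>S\<close>.\<close>
  define r where "r = pi / (2 * (b - a))"
  define w where "w x = cos (r * (x - a))" for x
  define S where "S t = sin (r * (t - a)) / r" for t
  define c where "c x = ennreal (sqrt (w x))" for x
  have r: "r > 0" using ab by (simp add: r_def)
  have rle: "r * (x - a) \<le> pi / 2" if "x \<le> b" for x
  proof -
    have "r * (x - a) \<le> r * (b - a)" using r that by (intro mult_left_mono) auto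
    also have "\<dots> = pi / 2" using ab by (simp add: r_def field_simps)
    finally show ?thesis .
  qed
  have rlt: "r * (x - a) < pi / 2" if "x < b" for x
  proof -
    have "r * (x - a) < r * (b - a)" using r that by (intro mult_strict_left_mono) auto
    also have "\<dots> = pi / 2" using ab by (simp add: r_def field_simps)
    finally show ?thesis .
  qed
  have w0: "w x \<ge> 0" if "a \<le> x" "x \<le> b" for x
    unfolding w_def using rle[of x] that r
    by (intro cos_ge_zero) (auto intro: order_trans[of _ 0])
  have wpos: "w x > 0" if "a \<le> x" "x < b" for x
    unfolding w_def using rlt[of x] that r
    by (intro cos_gt_zero_pi) (auto intro: less_le_trans[of _ 0])
  have S0: "S x \<ge> 0" if "a \<le> x" "x \<le> b" for x
    unfolding S_def using rle[of x] that r pi_gt_zero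
    by (intro divide_nonneg_pos sin_ge_zero) (auto simp del: pi_gt_zero)
  have dS: "(S has_real_derivative w t) (at t)" for t
    unfolding S_def w_def using r by (auto intro!: derivative_eq_intros)
  have dW: "((\<lambda>t. - w t / r\<^sup>2) has_real_derivative S t) (at t)" for t
    unfolding S_def w_def using r
    by (auto intro!: derivative_eq_intros simp: power2_eq_square field_simps)
  have [measurable]: "w \<in> borel_measurable borel" "S \<in> borel_measurable borel"
    unfolding w_def S_def by measurable
  have [measurable]: "c \<in> borel_measurable borel"
    unfolding c_def by measurable
  have c2: "(c x)\<^sup>2 = ennreal (w x)" if "a \<le> x" "x \<le> b" for x
    using w0[OF that] by (simp add: c_def ennreal_power)
  have cpos: "c x \<noteq> 0" "c x \<noteq> top" if "a \<le> x" "x < b" for x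
    using wpos[OF that] by (auto simp: c_def ennreal_eq_0_iff)
  have wb: "w b = 0"
  proof -
    have "r * (b - a) = pi / 2" using ab by (simp add: r_def field_simps)
    then show ?thesis unfolding w_def by (simp only: cos_pi_half)
  qed
  \<comment> \<open>In \<open>ennreal\<close> this needs care at 0 and \<open>top\<close>. On
    \<open>[a, b)\<close> the factor \<open>c x\<close> is neither, but \<open>c b = 0\<close>,
    hence the half-open range of \<open>t\<close>.\<close>
  have cancel: "f x / c x * c x = f x" if "a \<le> x" "x < b" for x
    using cpos[OF that] by (metis ennreal_times_divide mult.commute mult_divide_eq_ennreal)
  have CS: "(\<integral>\<^sup>+x\<in>{a..t}. f x \<partial>lborel)\<^sup>2
      \<le> (\<integral>\<^sup>+x\<in>{a..t}. (f x / c x)\<^sup>2 \<partial>lborel) * ennreal (S t)" if t: "a \<le> t" "t < b" for t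
  proof -
    have "(\<integral>\<^sup>+x\<in>{a..t}. f x \<partial>lborel)
      = (\<integral>\<^sup>+x. (f x / c x * indicator {a..t} x) * (c x * indicator {a..t} x) \<partial>lborel)"
      using t cancel by (intro nn_integral_cong) (auto simp: indicator_def)
    also have "\<dots>\<^sup>2 \<le> (\<integral>\<^sup>+x. (f x / c x * indicator {a..t} x)\<^sup>2 \<partial>lborel) *
        (\<integral>\<^sup>+x. (c x * indicator {a..t} x)\<^sup>2 \<partial>lborel)"
      by (intro Cauchy_Schwarz_nn_integral) auto
    also have "(\<integral>\<^sup>+x. (f x / c x * indicator {a..t} x)\<^sup>2 \<partial>lborel)
        = (\<integral>\<^sup>+x\<in>{a..t}. (f x / c x)\<^sup>2 \<partial>lborel)"
      by (intro nn_integral_cong) (auto simp: indicator_def)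
    also have "(\<integral>\<^sup>+x. (c x * indicator {a..t} x)\<^sup>2 \<partial>lborel) = (\<integral>\<^sup>+x\<in>{a..t}. ennreal (w x) \<partial>lborel)"
      using t c2 by (intro nn_integral_cong) (auto simp: indicator_def)
    also have "\<dots> \<le> ennreal (S t)"
      using t dS w0 by (intro nn_integral_FTC_Icc_lborel_le[where F = S]) (auto simp: S_def)
    finally show ?thesis by (simp add: mult_left_mono)
  qed
  have "(\<integral>\<^sup>+t\<in>{a..<b}. (\<integral>\<^sup>+x\<in>{a..t}. f x \<partial>lborel)\<^sup>2 \<partial>lborel)
    \<le> (\<integral>\<^sup>+t. (\<integral>\<^sup>+x\<in>{a..t}. (f x / c x)\<^sup>2 \<partial>lborel) * (ennreal (S t) * indicator {a..<b} t) \<partial>lborel)"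
    using CS by (intro nn_integral_mono) (auto simp: indicator_def)
  \<comment> \<open>The indicator of \<open>{a..t}\<close>, whose set depends on \<open>t\<close>,
    becomes a condition on the pair \<open>(x, t)\<close>, for which joint measurability is
    automatic. Tonelli then applies, and for fixed \<open>x\<close> the variable \<open>t\<close>
    runs from \<open>x\<close> to \<open>b\<close>.\<close>
  also have "\<dots> = (\<integral>\<^sup>+t. (\<integral>\<^sup>+x. (f x / c x)\<^sup>2 * (if a \<le> x \<and> x \<le> t then 1 else 0) *
      (ennreal (S t) * indicator {a..<b} t) \<partial>lborel) \<partial>lborel)"
    by (subst nn_integral_multc[symmetric])
      (auto intro!: nn_integral_cong simp: indicator_def)
  also have "\<dots> = (\<integral>\<^sup>+x. (\<integral>\<^sup>+t. (f x / c x)\<^sup>2 * (if a \<le> x \<and> x \<le> t then 1 else 0) *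
      (ennreal (S t) * indicator {a..<b} t) \<partial>lborel) \<partial>lborel)"
    by (rule lborel_pair.Fubini') measurable
  also have "\<dots> \<le> (\<integral>\<^sup>+x. ennreal ((1 / r)\<^sup>2) * ((f x)\<^sup>2 * indicator {a..<b} x) \<partial>lborel)"
  proof (rule nn_integral_mono)
    fix x
    show "(\<integral>\<^sup>+t. (f x / c x)\<^sup>2 * (if a \<le> x \<and> x \<le> t then 1 else 0) *
      (ennreal (S t) * indicator {a..<b} t) \<partial>lborel) \<le> ennreal ((1 / r)\<^sup>2) * ((f x)\<^sup>2 * indicator {a..<b} x)"
    proof (cases "a \<le> x \<and> x < b")
      case True
      then have x: "a \<le> x" "x < b" by auto
      have "(\<integral>\<^sup>+t. (f x / c x)\<^sup>2 * (if a \<le> x \<and> x \<le> t then 1 else 0) *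
          (ennreal (S t) * indicator {a..<b} t) \<partial>lborel)
        \<le> (\<integral>\<^sup>+t. (f x / c x)\<^sup>2 * (ennreal (S t) * indicator {x..b} t) \<partial>lborel)"
        by (intro nn_integral_mono) (auto simp: indicator_def)
      also have "\<dots> = (f x / c x)\<^sup>2 * (\<integral>\<^sup>+t\<in>{x..b}. ennreal (S t) \<partial>lborel)"
        by (rule nn_integral_cmult) measurable
      \<comment> \<open>Since \<open>w b = 0\<close>, the integral of \<open>S\<close> over
        \<open>[x, b]\<close> is \<open>w x / r\<^sup>2\<close>. The factor \<open>w x\<close> is
        \<open>(c x)\<^sup>2\<close>, which removes the weight from the denominator and leaves
        \<open>(1 / r)\<^sup>2\<close>.\<close>
      also have "\<dots> \<le> (f x / c x)\<^sup>2 * ennreal (w x / r\<^sup>2)"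
        using x dW S0 wb
        by (intro mult_left_mono nn_integral_FTC_Icc_lborel_le[where F = "\<lambda>t. - w t / r\<^sup>2"]) auto
      also have "ennreal (w x / r\<^sup>2) = ennreal ((1 / r)\<^sup>2) * (c x)\<^sup>2"
        using x c2[of x] w0[of x] by (simp add: ennreal_mult'[symmetric] power_divide)
      also have "(f x / c x)\<^sup>2 * (ennreal ((1 / r)\<^sup>2) * (c x)\<^sup>2)
          = ennreal ((1 / r)\<^sup>2) * (f x / c x * c x)\<^sup>2"
        by (simp add: power_mult_distrib mult_ac)
      also have "f x / c x * c x = f x"
        using x by (rule cancel)
      finally show ?thesis using x by simp
    next
      case False
      then have "(\<lambda>t. (f x / c x)\<^sup>2 * (if a \<le> x \<and> x \<le> t then 1 else 0) *
          (ennreal (S t) * indicator {a..<b} t)) = (\<lambda>t. 0)"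
        by (auto simp: indicator_def)
      then show ?thesis by simp
    qed
  qed
  also have "\<dots> = ennreal ((1 / r)\<^sup>2) * (\<integral>\<^sup>+x\<in>{a..<b}. (f x)\<^sup>2 \<partial>lborel)"
    by (rule nn_integral_cmult) measurable
  also have "1 / r = 2 * (b - a) / pi" by (simp add: r_def)
  finally show ?thesis .
qed

section \<open>The estimate on a single hold interval\<close>

lemma nn_integral_Icc_square_le:
  fixes f :: "real \<Rightarrow> ennreal"
  assumes [measurable]: "f \<in> borel_measurable borel" and "a \<le> b"
  shows "(\<integral>\<^sup>+x\<in>{a..b}. f x \<partial>lborel)\<^sup>2 \<le> ennreal (b - a) * (\<integral>\<^sup>+x\<in>{a..b}. (f x)\<^sup>2 \<partial>lborel)"
proof -
  have "(\<integral>\<^sup>+x\<in>{a..b}. f x \<partial>lborel)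
      = (\<integral>\<^sup>+x. (indicator {a..b} x) * (f x * indicator {a..b} x) \<partial>lborel)"
    by (intro nn_integral_cong) (auto simp: indicator_def)
  also have "\<dots>\<^sup>2 \<le> (\<integral>\<^sup>+x. (indicator {a..b} x)\<^sup>2 \<partial>lborel) * (\<integral>\<^sup>+x. (f x * indicator {a..b} x)\<^sup>2 \<partial>lborel)"
    by (intro Cauchy_Schwarz_nn_integral) auto
  also have "(\<integral>\<^sup>+x. (indicator {a..b} x)\<^sup>2 \<partial>lborel) = (\<integral>\<^sup>+x. indicator {a..b} x \<partial>lborel)"
    by (intro nn_integral_cong) (auto simp: indicator_def)
  also have "\<dots> = ennreal (b - a)" using assms by simp
  also have "(\<integral>\<^sup>+x. (f x * indicator {a..b} x)\<^sup>2 \<partial>lborel) = (\<integral>\<^sup>+x\<in>{a..b}. (f x)\<^sup>2 \<partial>lborel)"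
    by (intro nn_integral_cong) (auto simp: indicator_def)
  finally show ?thesis .
qed

text \<open>For finite arguments the difference of the two sides is
  \<open>(B * p - A * q)\<^sup>2 / (A * B)\<close>. The weights are chosen for later bounds with
  factors \<open>A\<^sup>2\<close> and \<open>B\<^sup>2\<close>: the resulting coefficients
  \<open>A * (A + B)\<close> and \<open>B * (A + B)\<close> add up to
  \<open>(A + B)\<^sup>2\<close>. This pointwise form takes the place of Minkowski's
  inequality.\<close>

lemma ennreal_power2_add_le:
  fixes x y :: ennreal and A B :: real
  assumes "A > 0" "B > 0"
  shows "(x + y)\<^sup>2 \<le> ennreal ((A + B) / A) * x\<^sup>2 + ennreal ((A + B) / B) * y\<^sup>2"
proof (cases "x = top \<or> y = top")
  case True
  have "(A + B) / A > 0" "(A + B) / B > 0" using assms by auto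
  then show ?thesis using True
    by (auto simp: ennreal_mult_eq_top_iff power2_eq_square ennreal_mult_top)
next
  case False
  then obtain p q where pq: "x = ennreal p" "y = ennreal q" "0 \<le> p" "0 \<le> q"
    by (cases x; cases y) auto
  have "(A + B) / A * p\<^sup>2 + (A + B) / B * q\<^sup>2 - (p + q)\<^sup>2 = (B * p - A * q)\<^sup>2 / (A * B)"
    using assms by (simp add: power2_eq_square field_simps)
  also have "\<dots> \<ge> 0" using assms by simp
  finally have "(p + q)\<^sup>2 \<le> (A + B) / A * p\<^sup>2 + (A + B) / B * q\<^sup>2" by simp
  moreover have "(x + y)\<^sup>2 = ennreal ((p + q)\<^sup>2)"
    using pq by (simp add: ennreal_plus[symmetric] ennreal_power del: ennreal_plus)
  moreover have "ennreal ((A + B) / A) * x\<^sup>2 + ennreal ((A + B) / B) * y\<^sup>2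
      = ennreal ((A + B) / A * p\<^sup>2 + (A + B) / B * q\<^sup>2)"
    using pq assms by (simp add: ennreal_power ennreal_mult'[symmetric] ennreal_plus[symmetric] del: ennreal_plus)
  ultimately show ?thesis by (simp add: ennreal_leI)
qed

text \<open>Here \<open>a\<close> is a sample, \<open>c\<close> its update and \<open>b\<close> the
  next update. Splitting the inner integral at \<open>c\<close> leaves a Wirtinger term and a term
  constant in \<open>t\<close>. \<open>A\<close> and \<open>B\<close> come from the uniform bounds
  \<open>h\<close> and \<open>n\<close>, and the integrals over \<open>[c, b)\<close> and
  \<open>[a, c]\<close> stay separate, because each is later summed over its own disjoint
  family.\<close>

lemma hold_interval_bound:
  fixes f :: "real \<Rightarrow> ennreal"
  assumes [measurable]: "f \<in> borel_measurable borel"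
    and ac: "a \<le> c" and cb: "c < b" and h: "b - a \<le> h" and n: "c - a \<le> n"
    and A: "A = 2 * h / pi" and B: "B = sqrt (h * n)"
  shows "(\<integral>\<^sup>+t\<in>{c..<b}. (\<integral>\<^sup>+x\<in>{a..t}. f x \<partial>lborel)\<^sup>2 \<partial>lborel)
    \<le> ennreal (A * (A + B)) * (\<integral>\<^sup>+x\<in>{c..<b}. (f x)\<^sup>2 \<partial>lborel)
      + ennreal (B * (A + B)) * (\<integral>\<^sup>+x\<in>{a..c}. (f x)\<^sup>2 \<partial>lborel)"
proof -
  define W where "W = (\<integral>\<^sup>+t\<in>{c..<b}. (\<integral>\<^sup>+x\<in>{c..t}. f x \<partial>lborel)\<^sup>2 \<partial>lborel)"
  define X where "X = (\<integral>\<^sup>+x\<in>{c..<b}. (f x)\<^sup>2 \<partial>lborel)"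
  define Y where "Y = (\<integral>\<^sup>+x\<in>{a..c}. (f x)\<^sup>2 \<partial>lborel)"
  define K where "K = (\<integral>\<^sup>+x\<in>{a..c}. f x \<partial>lborel)"
  have hpos: "h > 0" and n0: "n \<ge> 0" using assms by auto
  have Apos: "A > 0" and B0: "B \<ge> 0" using A B hpos n0 by auto
  have W: "W \<le> ennreal (A\<^sup>2) * X"
  proof -
    have "W \<le> ennreal ((2 * (b - c) / pi)\<^sup>2) * X"
      unfolding W_def X_def using cb by (intro wirtinger_nn_integral) auto
    also have "\<dots> \<le> ennreal (A\<^sup>2) * X"
      unfolding A using ac cb h
      by (intro mult_right_mono ennreal_leI power_mono divide_right_mono) auto
    finally show ?thesis .
  qed
  have m[measurable]: "(\<lambda>t. \<integral>\<^sup>+x\<in>{c..t}. f x \<partial>lborel) \<in> borel_measurable borel"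
  proof -
    have "(\<lambda>t. \<integral>\<^sup>+x. f x * (if c \<le> x \<and> x \<le> t then 1 else 0) \<partial>lborel) \<in> borel_measurable borel"
      by measurable
    then show ?thesis by (simp add: indicator_def)
  qed
  have split: "(\<integral>\<^sup>+x\<in>{a..t}. f x \<partial>lborel) \<le> (\<integral>\<^sup>+x\<in>{c..t}. f x \<partial>lborel) + K" for t
    unfolding K_def
    by (subst nn_integral_add[symmetric]) (auto intro!: nn_integral_mono simp: indicator_def)
  show ?thesis
  \<comment> \<open>The weight \<open>(A + B) / B\<close> requires \<open>B > 0\<close>. If
    \<open>B = 0\<close>, then \<open>n = 0\<close> because \<open>h > 0\<close>, so
    \<open>a = c\<close> and the Wirtinger term is all there is.\<close>
  proof (cases "B = 0")
    case True
    then have "a = c" using B hpos n n0 ac by auto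
    then have "(\<integral>\<^sup>+t\<in>{c..<b}. (\<integral>\<^sup>+x\<in>{a..t}. f x \<partial>lborel)\<^sup>2 \<partial>lborel) = W"
      by (simp add: W_def)
    then show ?thesis using W True unfolding X_def by (simp add: power2_eq_square)
  next
    case False
    then have Bpos: "B > 0" using B0 by simp
    \<comment> \<open>One factor \<open>h\<close> bounds the length of the range of
      \<open>t\<close>, and one factor \<open>n\<close> comes from Cauchy-Schwarz on
      \<open>[a, c]\<close>; their product is \<open>B\<^sup>2\<close>.\<close>
    have len: "ennreal (b - c) * K\<^sup>2 \<le> ennreal (B\<^sup>2) * Y"
    proof -
      have "ennreal (b - c) * K\<^sup>2 \<le> ennreal h * (ennreal n * Y)"
        unfolding K_def Y_def using ac cb h n
        by (intro mult_mono order_trans[OF nn_integral_Icc_square_le] ennreal_leI) auto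
      also have "\<dots> = ennreal (B\<^sup>2) * Y"
        using hpos n0 B by (simp add: ennreal_mult mult.assoc)
      finally show ?thesis .
    qed
    have "(\<integral>\<^sup>+t\<in>{c..<b}. (\<integral>\<^sup>+x\<in>{a..t}. f x \<partial>lborel)\<^sup>2 \<partial>lborel)
      \<le> (\<integral>\<^sup>+t. ennreal ((A + B) / A) * ((\<integral>\<^sup>+x\<in>{c..t}. f x \<partial>lborel)\<^sup>2 * indicator {c..<b} t)
            + (ennreal ((A + B) / B) * K\<^sup>2) * indicator {c..<b} t \<partial>lborel)"
    proof (intro nn_integral_mono)
      fix t
      have "(\<integral>\<^sup>+x\<in>{a..t}. f x \<partial>lborel)\<^sup>2 \<le> ((\<integral>\<^sup>+x\<in>{c..t}. f x \<partial>lborel) + K)\<^sup>2"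
        by (intro power_mono split) auto
      also have "\<dots> \<le> ennreal ((A + B) / A) * (\<integral>\<^sup>+x\<in>{c..t}. f x \<partial>lborel)\<^sup>2 + ennreal ((A + B) / B) * K\<^sup>2"
        by (rule ennreal_power2_add_le[OF Apos Bpos])
      finally show "(\<integral>\<^sup>+x\<in>{a..t}. f x \<partial>lborel)\<^sup>2 * indicator {c..<b} t
        \<le> ennreal ((A + B) / A) * ((\<integral>\<^sup>+x\<in>{c..t}. f x \<partial>lborel)\<^sup>2 * indicator {c..<b} t)
            + (ennreal ((A + B) / B) * K\<^sup>2) * indicator {c..<b} t"
        by (auto simp: indicator_def)
    qed
    also have "\<dots> = ennreal ((A + B) / A) * W + ennreal ((A + B) / B) * (ennreal (b - c) * K\<^sup>2)"
      using cb unfolding W_def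
      by (subst nn_integral_add)
        (simp_all add: nn_integral_cmult nn_integral_cmult_indicator mult.assoc, simp add: mult.commute)
    also have "\<dots> \<le> ennreal ((A + B) / A) * (ennreal (A\<^sup>2) * X) + ennreal ((A + B) / B) * (ennreal (B\<^sup>2) * Y)"
      by (intro add_mono mult_left_mono W len) auto
    also have "\<dots> = ennreal (A * (A + B)) * X + ennreal (B * (A + B)) * Y"
    proof -
      have "ennreal ((A + B) / P) * ennreal (P\<^sup>2) = ennreal (P * (A + B))" if "P > 0" for P
      proof -
        have "(A + B) / P * P\<^sup>2 = P * (A + B)"
          using that by (simp add: power2_eq_square)
        then show ?thesis using Apos Bpos that by (subst ennreal_mult'[symmetric]) auto
      qed
      then show ?thesis using Apos Bpos by (simp only: mult.assoc[symmetric])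
    qed
    finally show ?thesis unfolding X_def Y_def .
  qed
qed

section \<open>Event sequences\<close>

lemma admissible_strict_mono: "admissible e \<Longrightarrow> strict_mono e"
  unfolding admissible_def by (auto intro!: strict_mono_Suc_iff[THEN iffD2])

lemma admissible_finite:
  assumes "admissible e"
  shows "finite {k. e k \<in> {0..t}}"
proof -
  have "eventually (\<lambda>k. t < e k) sequentially"
    using assms unfolding admissible_def filterlim_at_top_dense by auto
  then obtain N where "\<And>k. k \<ge> N \<Longrightarrow> t < e k"
    by (auto simp: eventually_sequentially)
  then have "{k. e k \<in> {0..t}} \<subseteq> {..<N}" by (force simp: not_le)
  then show ?thesis by (rule finite_subset) simp
qed

text \<open>The indices of events in \<open>[0, t]\<close> form a finite nonempty initial segment,
  because \<open>e\<close> increases from 0 to infinity. This equivalence replaces the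
  \<open>Max\<close> in all later arguments.\<close>

lemma le_last_index_iff:
  assumes "admissible e" "0 \<le> t"
  shows "k \<le> last_index e t \<longleftrightarrow> e k \<le> t"
proof -
  have ne: "{k. e k \<in> {0..t}} \<noteq> {}" and nonneg: "\<And>k. 0 \<le> e k"
    using assms by (auto simp: admissible_def intro!: exI[of _ 0])
  show ?thesis
    unfolding last_index_def Max_ge_iff[OF admissible_finite[OF assms(1)] ne]
    using nonneg strict_mono_less_eq[OF admissible_strict_mono[OF assms(1)]]
    by (auto intro: order_trans)
qed

lemma next_update_props:
  assumes "admissible u"
  shows "next_update s u k \<in> range u" "s k \<le> next_update s u k"
    "s k \<le> u m \<Longrightarrow> next_update s u k \<le> u m"
proof -
  have "eventually (\<lambda>m. s k \<le> u m) sequentially"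
    using assms unfolding admissible_def filterlim_at_top by auto
  then have ex: "\<exists>m. s k \<le> u m" by (auto simp: eventually_sequentially)
  \<comment> \<open>A \<open>LEAST\<close> over the reals is meaningful only once a minimum is
    exhibited. The least index exists by well-ordering, and monotonicity of \<open>u\<close> turns
    it into the least value.\<close>
  define m0 where "m0 = (LEAST m. s k \<le> u m)"
  have m0: "s k \<le> u m0" unfolding m0_def using ex by (rule LeastI_ex)
  have least: "u m0 \<le> u m" if "s k \<le> u m" for m
    using strict_mono_less_eq[OF admissible_strict_mono[OF assms]] that
    unfolding m0_def by (auto intro: Least_le)
  have "next_update s u k = u m0"
    unfolding next_update_def using m0 least by (intro Least_equality) auto
  then show "next_update s u k \<in> range u" "s k \<le> next_update s u k"
    "s k \<le> u m \<Longrightarrow> next_update s u k \<le> u m"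
    using m0 least by auto
qed

text \<open>Two equivalences compose: sample \<open>k\<close> is held at \<open>t\<close> or already
  superseded iff \<open>s k\<close> is at most the last update up to \<open>t\<close>. That update,
  if at or after \<open>s k\<close>, is at least \<phi>_k; conversely \<phi>_k is itself an update,
  so \<phi>_k \<le> t puts it at or before the last one.\<close>

lemma le_held_index_iff:
  assumes s: "admissible s" and u: "admissible u" and t: "0 \<le> t"
  shows "k \<le> held_index s u t \<longleftrightarrow> next_update s u k \<le> t"
proof -
  have u0: "0 \<le> u (last_index u t)" using u by (simp add: admissible_def)
  have ut: "u (last_index u t) \<le> t" using le_last_index_iff[OF u t] by auto
  have "k \<le> held_index s u t \<longleftrightarrow> s k \<le> u (last_index u t)"
    unfolding held_index_def by (rule le_last_index_iff[OF s u0])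
  also have "\<dots> \<longleftrightarrow> next_update s u k \<le> t"
  proof
    assume "s k \<le> u (last_index u t)"
    then show "next_update s u k \<le> t" using next_update_props(3)[OF u] ut by (meson order_trans)
  next
    assume "next_update s u k \<le> t"
    moreover obtain m where m: "next_update s u k = u m" using next_update_props(1)[OF u] by blast
    ultimately have "m \<le> last_index u t" using le_last_index_iff[OF u t] by simp
    then have "u m \<le> u (last_index u t)"
      using strict_mono_less_eq[OF admissible_strict_mono[OF u]] by blast
    then show "s k \<le> u (last_index u t)" using m next_update_props(2)[OF u, of s k] by simp
  qed
  finally show ?thesis .
qed

text \<open>When several samples share their next update, all but the last of them get an empty
  interval and are never held.\<close>

lemma held_index_eq_iff:
  assumes "admissible s" "admissible u" "0 \<le> t"
  shows "held_index s u t = k \<longleftrightarrow> t \<in> {next_update s u k..<next_update s u (Suc k)}"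
  using le_held_index_iff[OF assms, of k] le_held_index_iff[OF assms, of "Suc k"] by auto

text \<open>Otherwise \<phi>_k would be an update at or after \<open>s (Suc k)\<close>, and
  minimality would give \<phi>_(k+1) \<le> \<phi>_k.\<close>

lemma next_update_less_next_sample:
  assumes u: "admissible u" and lt: "next_update s u k < next_update s u (Suc k)"
  shows "next_update s u k < s (Suc k)"
  using next_update_props(1)[OF u, of s k] next_update_props(3)[OF u, of s "Suc k"] lt
  by (metis imageE not_le)

text \<open>The bound \<open>\<tau>n\<close> measures \<phi>_k from the last sample up to \<phi>_k.
  On a nonempty hold interval the sample \<open>s (Suc k)\<close> comes after \<phi>_k, so that last
  sample is \<open>s k\<close>.\<close>

lemma event_bounds_hold:
  assumes s: "admissible s" and u: "admissible u" and eb: "event_bounds \<tau>s \<tau>u \<tau>d \<tau>n s u"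
    and lt: "next_update s u k < next_update s u (Suc k)"
  shows "next_update s u (Suc k) - s k \<le> \<tau>s + \<tau>d" "next_update s u k - s k \<le> \<tau>n"
proof -
  have "next_update s u (Suc k) - s (Suc k) \<le> \<tau>d" "s (Suc k) - s k \<le> \<tau>s"
    using eb unfolding event_bounds_def by auto
  then show "next_update s u (Suc k) - s k \<le> \<tau>s + \<tau>d" by simp
  have "Max (range s \<inter> {0..next_update s u k}) = s k"
  proof (rule Max_eqI)
    have "range s \<inter> {0..next_update s u k} = s ` {j. s j \<in> {0..next_update s u k}}" by auto
    then show "finite (range s \<inter> {0..next_update s u k})" using admissible_finite[OF s] by simp
    show "s k \<in> range s \<inter> {0..next_update s u k}"
      using s next_update_props(2)[OF u] by (auto simp: admissible_def)
  next
    fix y assume "y \<in> range s \<inter> {0..next_update s u k}"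
    then obtain j where j: "y = s j" "s j < s (Suc k)"
      using next_update_less_next_sample[OF u lt] by auto
    then show "y \<le> s k"
      using strict_mono_less_eq[OF admissible_strict_mono[OF s]]
        strict_mono_less[OF admissible_strict_mono[OF s]] by auto
  qed
  then show "next_update s u k - s k \<le> \<tau>n"
    using eb unfolding event_bounds_def by metis
qed

section \<open>The delay operator\<close>

text \<open>Elements of \<open>L2\<close> are measurable for the completed sigma-algebra, while the
  estimates above are for Borel functions. Changing \<open>v\<close> on a null set, and to 0 off the
  half-line, preserves \<open>integrator v t\<close> for every \<open>t\<close>, hence
  \<open>Delta s u v\<close> pointwise.\<close>

lemma L2_borel_representative:
  assumes "v \<in> L2"
  obtains g :: "real \<Rightarrow> real" where "g \<in> borel_measurable borel"
    "\<And>t. integrator v t = (\<integral>x. indicator {0..t} x * g x \<partial>lborel)"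
    "integrable lborel (\<lambda>x. (g x)\<^sup>2)"
    "(\<integral>\<^sup>+x. (ennreal \<bar>g x\<bar>)\<^sup>2 \<partial>lborel) = ennreal ((L2_norm v)\<^sup>2)"
proof -
  have m: "(\<lambda>x. indicator {0..} x * v x) \<in> borel_measurable lebesgue"
    and int: "integrable lebesgue (\<lambda>x. indicator {0..} x * (v x)\<^sup>2)"
    using assms by (auto simp: L2_def set_borel_measurable_def set_integrable_def)
  obtain g where g: "g \<in> borel_measurable lborel"
    and ae: "AE x in lborel. indicator {0..} x * v x = g x"
    using completion_ex_borel_measurable_real[OF m] by blast
  from g have [measurable]: "g \<in> borel_measurable borel" by simp
  have g_leb[measurable]: "g \<in> borel_measurable lebesgue"
    using g by (rule measurable_completion)
  have ae': "AE x in lebesgue. indicator {0..} x * v x = g x"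
    using ae by (rule AE_completion)
  have integ: "integrator v t = (\<integral>x. indicator {0..t} x * g x \<partial>lborel)" for t
  proof -
    have "(\<lambda>x. indicator {0..t} x * v x) = (\<lambda>x. indicator {0..t} x * (indicator {0..} x * v x))"
      by (auto simp: indicator_def)
    also have "\<dots> \<in> borel_measurable lebesgue" by (intro borel_measurable_times[OF _ m] measurable_completion) simp
    finally have m': "(\<lambda>x. indicator {0..t} x * v x) \<in> borel_measurable lebesgue" .
    have "integrator v t = (\<integral>x. indicator {0..t} x * v x \<partial>lebesgue)"
      by (simp add: integrator_def set_lebesgue_integral_def)
    also have "\<dots> = (\<integral>x. indicator {0..t} x * g x \<partial>lebesgue)"
    proof (rule integral_cong_AE)
      show "AE x in lebesgue. indicator {0..t} x * v x = indicator {0..t} x * g x"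
        using ae' by eventually_elim (auto simp: indicator_def split: if_splits)
      show "(\<lambda>x. indicator {0..t} x * g x) \<in> borel_measurable lebesgue"
        by (intro measurable_completion) measurable
    qed (rule m')
    also have "\<dots> = (\<integral>x. indicator {0..t} x * g x \<partial>lborel)"
      by (rule integral_completion) measurable
    finally show ?thesis .
  qed
  have ae2: "AE x in lebesgue. indicator {0..} x * (v x)\<^sup>2 = (g x)\<^sup>2"
    using ae' by eventually_elim (auto simp: indicator_def split: if_splits)
  have g2m: "(\<lambda>x. (g x)\<^sup>2) \<in> borel_measurable lebesgue" by measurable
  have i_leb: "integrable lebesgue (\<lambda>x. (g x)\<^sup>2)"
    using integrable_cong_AE_imp[OF int g2m] ae2 by (auto simp: eq_commute)
  then have i: "integrable lborel (\<lambda>x. (g x)\<^sup>2)"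
    by (simp add: integrable_completion)
  have "(L2_norm v)\<^sup>2 = (\<integral>x. indicator {0..} x * (v x)\<^sup>2 \<partial>lebesgue)"
    unfolding L2_norm_def set_lebesgue_integral_def
    by (simp add: integral_nonneg_AE)
  also have "\<dots> = (\<integral>x. (g x)\<^sup>2 \<partial>lebesgue)"
    using int g2m ae2 by (intro integral_cong_AE) auto
  also have "\<dots> = (\<integral>x. (g x)\<^sup>2 \<partial>lborel)"
    by (rule integral_completion) measurable
  finally have "(\<integral>\<^sup>+x. (ennreal \<bar>g x\<bar>)\<^sup>2 \<partial>lborel) = ennreal ((L2_norm v)\<^sup>2)"
    using i by (simp add: ennreal_power nn_integral_eq_integral)
  from that[OF \<open>g \<in> borel_measurable borel\<close> integ i this] show ?thesis .
qed

text \<open>On a bounded interval \<open>1 + (g x)\<^sup>2\<close> is an integrable majorant. This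
  licenses subtracting two values of \<open>integrator\<close>, whose Bochner integrals would
  otherwise default to 0.\<close>

lemma integrable_indicator_of_square_integrable:
  fixes g :: "real \<Rightarrow> real"
  assumes [measurable]: "g \<in> borel_measurable borel" and "integrable lborel (\<lambda>x. (g x)\<^sup>2)"
  shows "integrable lborel (\<lambda>x. indicator {a..b} x * g x)"
proof (rule Bochner_Integration.integrable_bound)
  show "integrable lborel (\<lambda>x. indicator {a..b} x + (g x)\<^sup>2)"
    using assms(2)
    by (intro Bochner_Integration.integrable_add integrable_real_indicator)
      (auto simp: emeasure_bounded_finite[unfolded infinity_ennreal_def])
  have "\<bar>y\<bar> \<le> 1 + y\<^sup>2" for y :: real
    using zero_le_power2[of "\<bar>y\<bar> - 1"] by (simp add: power2_diff)
  then show "AE x in lborel. norm (indicator {a..b} x * g x) \<le> norm (indicator {a..b} x + (g x)\<^sup>2)"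
    by (auto simp: indicator_def)
qed measurable

section \<open>Summation over the hold intervals\<close>

lemma suminf_disjoint_nn_integral_le:
  assumes [measurable]: "f \<in> borel_measurable M" "\<And>k. B k \<in> sets M" and "disjoint_family B"
  shows "(\<Sum>k. \<integral>\<^sup>+x\<in>B k. f x \<partial>M) \<le> (\<integral>\<^sup>+x. f x \<partial>M)"
proof -
  have "(\<Sum>k. \<integral>\<^sup>+x\<in>B k. f x \<partial>M) = (\<integral>\<^sup>+x. (\<Sum>k. f x * indicator (B k) x) \<partial>M)"
    by (rule nn_integral_suminf[symmetric]) measurable
  also have "\<dots> \<le> (\<integral>\<^sup>+x. f x \<partial>M)"
    unfolding ennreal_suminf_cmult suminf_indicator[OF assms(3)]
    by (intro nn_integral_mono) (auto simp: indicator_def)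
  finally show ?thesis .
qed

text \<open>With nonnegative integrals the bound makes sense before square integrability of
  \<open>Delta s u v\<close> is known, so that property can be deduced from it.\<close>

lemma Delta_nn_integral_bound:
  fixes g :: "real \<Rightarrow> real"
  assumes pos: "0 < \<tau>s" "0 \<le> \<tau>d" "0 \<le> \<tau>n"
    and s: "admissible s" and u: "admissible u"
    and eb: "event_bounds \<tau>s \<tau>u \<tau>d \<tau>n s u"
    and g[measurable]: "g \<in> borel_measurable borel"
    and integ: "\<And>t. integrator v t = (\<integral>x. indicator {0..t} x * g x \<partial>lborel)"
    and g2: "integrable lborel (\<lambda>x. (g x)\<^sup>2)"
  shows "(\<lambda>t. indicator {0..} t * Delta s u v t) \<in> borel_measurable borel"
    and "(\<integral>\<^sup>+t\<in>{0..}. ennreal ((Delta s u v t)\<^sup>2) \<partial>lborel)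
      \<le> ennreal ((2 * (\<tau>s + \<tau>d) / pi + sqrt ((\<tau>s + \<tau>d) * \<tau>n))\<^sup>2) *
        (\<integral>\<^sup>+x. (ennreal \<bar>g x\<bar>)\<^sup>2 \<partial>lborel)"
proof -
  define f where "f x = ennreal \<bar>g x\<bar>" for x
  define \<phi> where "\<phi> k = next_update s u k" for k
  define I where "I k = {\<phi> k..<\<phi> (Suc k)}" for k
  \<comment> \<open>The empty case is what makes the family disjoint: samples that share an update
    \<phi>_k would give intervals that all contain \<phi>_k.\<close>
  define J where "J k = (if \<phi> k < \<phi> (Suc k) then {s k..\<phi> k} else {})" for k
  define A where "A = 2 * (\<tau>s + \<tau>d) / pi"
  define B where "B = sqrt ((\<tau>s + \<tau>d) * \<tau>n)"
  have [measurable]: "f \<in> borel_measurable borel" unfolding f_def by measurable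
  have A0: "A \<ge> 0" and B0: "B \<ge> 0" using pos by (auto simp: A_def B_def)
  have s0: "0 \<le> s k" for k using s by (simp add: admissible_def)
  have s\<phi>: "s k \<le> \<phi> k" for k unfolding \<phi>_def by (rule next_update_props(2)[OF u])
  have I_sets[measurable]: "I k \<in> sets borel" and J_sets[measurable]: "J k \<in> sets borel" for k
    by (auto simp: I_def J_def)
  have I_iff: "t \<in> I k \<longleftrightarrow> held_index s u t = k" if "0 \<le> t" for t k
    using held_index_eq_iff[OF s u that] by (simp add: I_def \<phi>_def)
  have I_nonneg: "0 \<le> t" if "t \<in> I k" for t k
    using that s0[of k] s\<phi>[of k] by (auto simp: I_def)
  have disjI: "disjoint_family I"
  proof -
    have "j = k" if "t \<in> I j" "t \<in> I k" for j k t
      using I_iff[OF I_nonneg[OF that(1)]] that by simp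
    then show ?thesis by (auto simp: disjoint_family_on_def)
  qed
  \<comment> \<open>\<open>J k\<close> lies in \<open>[s k, s (Suc k))\<close>, so the index is
    recovered from any point of \<open>J k\<close>.\<close>
  have J_last: "last_index s x = k" if "x \<in> J k" for x k
  proof -
    have x: "s k \<le> x" "x < s (Suc k)"
      using that next_update_less_next_sample[OF u, of s k] unfolding J_def \<phi>_def
      by (auto split: if_splits)
    then have "0 \<le> x" using s0[of k] by simp
    then show ?thesis
      using le_last_index_iff[OF s, of x k] le_last_index_iff[OF s, of x "Suc k"] x by auto
  qed
  have disjJ: "disjoint_family J"
  proof -
    have "j = k" if "x \<in> J j" "x \<in> J k" for j k x
      using J_last[OF that(1)] J_last[OF that(2)] by simp
    then show ?thesis by (auto simp: disjoint_family_on_def)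
  qed
  have Delta_I: "Delta s u v t = integrator v t - integrator v (s k)" if "t \<in> I k" for t k
    using I_iff[OF I_nonneg[OF that]] that
    by (simp add: Delta_def delay_op_def total_delay_def)
  have [measurable]: "integrator v \<in> borel_measurable borel"
  proof -
    have "(\<lambda>t. \<integral>x. (if 0 \<le> x \<and> x \<le> t then 1 else 0) * g x \<partial>lborel) \<in> borel_measurable borel"
      by measurable
    moreover have "integrator v = (\<lambda>t. \<integral>x. (if 0 \<le> x \<and> x \<le> t then 1 else 0) * g x \<partial>lborel)"
      unfolding integ fun_eq_iff
      by (intro allI Bochner_Integration.integral_cong) (auto simp: indicator_def)
    ultimately show ?thesis by simp
  qed
  have [measurable]: "(\<lambda>t. \<integral>\<^sup>+x\<in>{a..t}. f x \<partial>lborel) \<in> borel_measurable borel" for a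
  proof -
    have "(\<lambda>t. \<integral>\<^sup>+x. f x * (if a \<le> x \<and> x \<le> t then 1 else 0) \<partial>lborel) \<in> borel_measurable borel"
      by measurable
    then show ?thesis by (simp add: indicator_def)
  qed
  show "(\<lambda>t. indicator {0..} t * Delta s u v t) \<in> borel_measurable borel"
  proof (rule measurable_piecewise_restrict2)
    \<comment> \<open>The negative half-line followed by the hold intervals is a countable Borel
      cover of the line. The function is 0 on the former and \<open>integrator v\<close> minus a
      constant on each of the latter.\<close>
    let ?A = "case_nat {..<0} I"
    show "?A n \<in> sets borel" for n by (cases n) auto
    show "space borel = (\<Union>n. ?A n)"
    proof -
      have "t \<in> (\<Union>n. ?A n)" for t
      proof (cases "t < 0")
        case True
        then have "t \<in> ?A 0" by simp
        then show ?thesis by blast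
      next
        case False
        then have "t \<in> ?A (Suc (held_index s u t))" using I_iff by simp
        then show ?thesis by blast
      qed
      then show ?thesis by auto
    qed
    show "\<exists>h\<in>borel_measurable borel. \<forall>t\<in>?A n. indicator {0..} t * Delta s u v t = h t" for n
    proof (cases n)
      case 0
      then show ?thesis by (intro bexI[of _ "\<lambda>_. 0"]) auto
    next
      case (Suc k)
      then show ?thesis
        by (intro bexI[of _ "\<lambda>t. integrator v t - integrator v (s k)"])
          (auto simp: Delta_I dest: I_nonneg)
    qed
  qed
  have diff: "ennreal \<bar>integrator v t - integrator v a\<bar> \<le> (\<integral>\<^sup>+x\<in>{a..t}. f x \<partial>lborel)"
    if "0 \<le> a" "a \<le> t" for a t
  proof -
    note i = integrable_indicator_of_square_integrable[OF g g2, of 0]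
    have "integrator v t - integrator v a
        = (\<integral>x. indicator {0..t} x * g x - indicator {0..a} x * g x \<partial>lborel)"
      unfolding integ using i by simp
    also have "ennreal \<bar>\<dots>\<bar> \<le> (\<integral>\<^sup>+x. norm (indicator {0..t} x * g x - indicator {0..a} x * g x) \<partial>lborel)"
      using i integral_norm_bound_ennreal[OF Bochner_Integration.integrable_diff[OF i[of t] i[of a]]]
      by simp
    also have "\<dots> \<le> (\<integral>\<^sup>+x\<in>{a..t}. f x \<partial>lborel)"
      using that by (intro nn_integral_mono) (auto simp: indicator_def f_def)
    finally show ?thesis .
  qed
  define H where "H k t = (\<integral>\<^sup>+x\<in>{s k..t}. f x \<partial>lborel)\<^sup>2 * indicator (I k) t" for k t
  have [measurable]: "H k \<in> borel_measurable borel" for k unfolding H_def by measurable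
  have "(\<integral>\<^sup>+t\<in>{0..}. ennreal ((Delta s u v t)\<^sup>2) \<partial>lborel) \<le> (\<integral>\<^sup>+t. (\<Sum>k. H k t) \<partial>lborel)"
  proof (rule nn_integral_mono)
    fix t
    show "ennreal ((Delta s u v t)\<^sup>2) * indicator {0..} t \<le> (\<Sum>k. H k t)"
    proof (cases "0 \<le> t")
      case True
      define k where "k = held_index s u t"
      have tk: "t \<in> I k" using I_iff[OF True] by (simp add: k_def)
      then have "s k \<le> t" using s\<phi>[of k] by (auto simp: I_def)
      have "ennreal ((Delta s u v t)\<^sup>2) = (ennreal \<bar>integrator v t - integrator v (s k)\<bar>)\<^sup>2"
        using Delta_I[OF tk] by (simp add: ennreal_power)
      also have "\<dots> \<le> H k t"
        using diff[OF s0 \<open>s k \<le> t\<close>] tk by (auto simp: H_def intro: power_mono)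
      also have "\<dots> \<le> (\<Sum>k. H k t)"
        using sum_le_suminf[of "\<lambda>k. H k t" "{k}"] by (simp add: summableI)
      finally show ?thesis using True by simp
    qed simp
  qed
  also have "\<dots> = (\<Sum>k. \<integral>\<^sup>+t. H k t \<partial>lborel)"
    by (rule nn_integral_suminf) measurable
  also have "\<dots> \<le> (\<Sum>k. ennreal (A * (A + B)) * (\<integral>\<^sup>+x\<in>I k. (f x)\<^sup>2 \<partial>lborel)
      + ennreal (B * (A + B)) * (\<integral>\<^sup>+x\<in>J k. (f x)\<^sup>2 \<partial>lborel))"
  proof (rule suminf_le)
    fix k
    show "(\<integral>\<^sup>+t. H k t \<partial>lborel) \<le> ennreal (A * (A + B)) * (\<integral>\<^sup>+x\<in>I k. (f x)\<^sup>2 \<partial>lborel)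
      + ennreal (B * (A + B)) * (\<integral>\<^sup>+x\<in>J k. (f x)\<^sup>2 \<partial>lborel)"
    proof (cases "\<phi> k < \<phi> (Suc k)")
      case True
      then show ?thesis
        using hold_interval_bound[of f "s k" "\<phi> k" "\<phi> (Suc k)" "\<tau>s + \<tau>d" \<tau>n A B]
          s\<phi>[of k] event_bounds_hold[OF s u eb, of k]
        unfolding H_def I_def J_def \<phi>_def A_def B_def by simp
    next
      case False
      then show ?thesis by (simp add: H_def I_def)
    qed
  qed (auto intro: summableI)
  also have "\<dots> = ennreal (A * (A + B)) * (\<Sum>k. \<integral>\<^sup>+x\<in>I k. (f x)\<^sup>2 \<partial>lborel)
      + ennreal (B * (A + B)) * (\<Sum>k. \<integral>\<^sup>+x\<in>J k. (f x)\<^sup>2 \<partial>lborel)"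
    by (subst suminf_add[symmetric]) (auto intro: summableI)
  \<comment> \<open>Each family is disjoint, so both sums are at most the same total integral, and
    the coefficients add up to \<open>(A + B)\<^sup>2\<close>.\<close>
  also have "\<dots> \<le> ennreal (A * (A + B)) * (\<integral>\<^sup>+x. (f x)\<^sup>2 \<partial>lborel)
      + ennreal (B * (A + B)) * (\<integral>\<^sup>+x. (f x)\<^sup>2 \<partial>lborel)"
    by (intro add_mono mult_left_mono suminf_disjoint_nn_integral_le disjI disjJ) auto
  also have "\<dots> = ennreal ((A + B)\<^sup>2) * (\<integral>\<^sup>+x. (f x)\<^sup>2 \<partial>lborel)"
    using A0 B0
    by (simp add: distrib_right[symmetric] ennreal_plus[symmetric] power2_eq_square del: ennreal_plus)
  finally show "(\<integral>\<^sup>+t\<in>{0..}. ennreal ((Delta s u v t)\<^sup>2) \<partial>lborel)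
      \<le> ennreal ((2 * (\<tau>s + \<tau>d) / pi + sqrt ((\<tau>s + \<tau>d) * \<tau>n))\<^sup>2) *
        (\<integral>\<^sup>+x. (ennreal \<bar>g x\<bar>)\<^sup>2 \<partial>lborel)"
    unfolding A_def B_def f_def .
qed

text \<open>Measurability and a finite nonnegative integral give integrability. The Bochner integral
  in \<open>L2_norm\<close> then equals that nonnegative integral and inherits the bound.\<close>

lemma L2_of_nn_integral_bound:
  assumes m: "(\<lambda>t. indicator {0..} t * w t) \<in> borel_measurable borel"
    and le: "(\<integral>\<^sup>+t\<in>{0..}. ennreal ((w t)\<^sup>2) \<partial>lborel) \<le> ennreal (C\<^sup>2)" and C: "0 \<le> C"
  shows "w \<in> L2" "L2_norm w \<le> C"
proof -
  have ml: "(\<lambda>t. indicator {0..} t * w t) \<in> borel_measurable lebesgue"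
    using m by (intro measurable_completion) simp
  have eq: "indicator {0..} t * (w t)\<^sup>2 = (indicator {0..} t * w t)\<^sup>2" for t :: real
    by (auto simp: indicator_def)
  have ml2: "(\<lambda>t. indicator {0..} t * (w t)\<^sup>2) \<in> borel_measurable lebesgue"
    unfolding eq using ml by (rule borel_measurable_power)
  have nn: "(\<integral>\<^sup>+t. ennreal (indicator {0..} t * (w t)\<^sup>2) \<partial>lebesgue) \<le> ennreal (C\<^sup>2)"
    using le unfolding nn_integral_completion
    by (simp add: ennreal_mult' mult.commute ennreal_indicator)
  have int: "integrable lebesgue (\<lambda>t. indicator {0..} t * (w t)\<^sup>2)"
    using ml2 nn by (intro integrableI_nonneg) (auto intro: le_less_trans)
  then show "w \<in> L2"
    using ml by (simp add: L2_def set_borel_measurable_def set_integrable_def)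
  have "ennreal (\<integral>t. indicator {0..} t * (w t)\<^sup>2 \<partial>lebesgue) \<le> ennreal (C\<^sup>2)"
    using nn nn_integral_eq_integral[OF int] by simp
  then have "(\<integral>t. indicator {0..} t * (w t)\<^sup>2 \<partial>lebesgue) \<le> C\<^sup>2"
    by (simp add: ennreal_le_iff)
  then show "L2_norm w \<le> C"
    unfolding L2_norm_def set_lebesgue_integral_def using C by (auto intro: real_le_lsqrt)
qed

text \<open>Membership in \<open>L2\<close> belongs to the conclusion because \<open>L2_norm\<close>
  would be 0 by convention for a function that is not square integrable, making the inequality alone
  vacuous there.\<close>

theorem lemma3:
  fixes \<tau>s \<tau>u \<tau>d \<tau>n :: real
    and s u :: "nat \<Rightarrow> real"
    and v :: "real \<Rightarrow> real"
  assumes "0 < \<tau>s" and "0 < \<tau>u"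
    and "\<tau>d \<in> {0..\<tau>u}" and "\<tau>n \<in> {0..min \<tau>d \<tau>s}"
    and "admissible s" and "admissible u"
    and "event_bounds \<tau>s \<tau>u \<tau>d \<tau>n s u"
    and "v \<in> L2"
  shows "Delta s u v \<in> L2 \<and>
    L2_norm (Delta s u v) \<le> (2 * (\<tau>s + \<tau>d) / pi + sqrt ((\<tau>s + \<tau>d) * \<tau>n)) * L2_norm v"
proof -
  let ?C = "2 * (\<tau>s + \<tau>d) / pi + sqrt ((\<tau>s + \<tau>d) * \<tau>n)"
  obtain g where g: "g \<in> borel_measurable borel"
    "\<And>t. integrator v t = (\<integral>x. indicator {0..t} x * g x \<partial>lborel)"
    "integrable lborel (\<lambda>x. (g x)\<^sup>2)"
    and norm: "(\<integral>\<^sup>+x. (ennreal \<bar>g x\<bar>)\<^sup>2 \<partial>lborel) = ennreal ((L2_norm v)\<^sup>2)"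
    using L2_borel_representative[OF \<open>v \<in> L2\<close>] by blast
  have "0 \<le> \<tau>d" "0 \<le> \<tau>n" using assms by auto
  note D = Delta_nn_integral_bound[OF \<open>0 < \<tau>s\<close> this assms(5-7) g]
  have "0 \<le> L2_norm v"
    unfolding L2_norm_def set_lebesgue_integral_def by (simp add: integral_nonneg_AE)
  then have C: "0 \<le> ?C * L2_norm v"
    using \<open>0 < \<tau>s\<close> \<open>0 \<le> \<tau>d\<close> \<open>0 \<le> \<tau>n\<close> by (intro mult_nonneg_nonneg add_nonneg_nonneg) auto
  have "(\<integral>\<^sup>+t\<in>{0..}. ennreal ((Delta s u v t)\<^sup>2) \<partial>lborel) \<le> ennreal ((?C * L2_norm v)\<^sup>2)"
    using D(2) by (simp add: norm ennreal_mult'[symmetric] power_mult_distrib)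
  note bound = L2_of_nn_integral_bound[OF D(1) this C]
  show ?thesis using bound by (rule conjI)
qed

end
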